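(* Let $X$ be a non-negative random variable with distribution $F_X$ such that $\psi_{F_X}(\lambda)=\mathbb{E}[\log(1+\lambda X)]<\infty$ for all $\lambda>0$. For $c>0$ set $A_c=cX/(cX+1)$, with distribution $F_{A_c}$, and define $\Phi_{F_{A_c}}(y)=\mathbb{E}[\log(|y-A_c|)\,\mathbb{I}(A_c\ne y)]$. Then for $0<y<1$, $$\Phi_{F_{A_c}}(y)=\Phi_{F_X}\!\left(\frac{y}{c(1-y)}\right)-\psi_{F_X}(c)+\log(c(1-y)).$$
   Context: $\mathbb{I}(\cdot)$ denotes the indicator function, and $\Phi_{F_X}(t)=\mathbb{E}[\log(|t-X|)\,\mathbb{I}(t\ne X)]=\int_0^\infty \log(|t-x|)\,\mathbb{I}(t\neq x)\,F_X(dx)$.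
   Formalization: The identity fails if X has an atom at t = y/(c(1-y)) (e.g. X = 1, c = 1, y = 1/2); it is stated when P(X = t) = 0, and in general with the extra term -P(X = t) log(c(1-y)^2) on the right-hand side. *)

theory Defs
  imports "HOL-Probability.Probability"
begin

(* The logarithmic potential may be minus infinity (the singularity of log at t need not be
   integrable), and the Bochner integral is 0 for non-integrable functions.  Expectations are
   therefore taken in the extended reals, as positive part minus negative part.  For ereal,
   infinity - infinity = infinity; this case does not arise for the functions integrated below
   when log (1 + X) is integrable, since the positive parts then have finite integrals. *)
definition ext_integral :: "'a measure \<Rightarrow> ('a \<Rightarrow> real) \<Rightarrow> ereal" where
  "ext_integral M f =
     enn2ereal (\<integral>\<^sup>+ x. ennreal (f x) \<partial>M) - enn2ereal (\<integral>\<^sup>+ x. ennreal (- f x) \<partial>M)"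

(* The atom at t is left out of the integral.  Hence an identity obtained from
   y - A = c (1 - y) (t - X) / (1 + c X), with A = c X / (c X + 1) and t = y / (c (1 - y)), holds
   off the event X = t only.  On that event 1 + c X = 1 / (1 - y), so psi F c and log (c (1 - y))
   together contribute P (X = t) * log (c (1 - y)^2) too much when F has an atom at t. *)
definition Phi :: "real measure \<Rightarrow> real \<Rightarrow> ereal" where
  "Phi F t = ext_integral F (\<lambda>x. ln \<bar>t - x\<bar> * indicator {x. t \<noteq> x} x)"

definition psi :: "real measure \<Rightarrow> real \<Rightarrow> ereal" where
  "psi F l = ext_integral F (\<lambda>x. ln (1 + l * x))"

end

theory Submission
  imports Defs
begin

text \<open>
  Put \<open>t = y / (c (1 - y))\<close> and let \<open>F\<close> be the law of \<open>X\<close>.  The map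
  \<open>x \<mapsto> c x / (c x + 1)\<close> is a Moebius transformation that sends \<open>t\<close> to \<open>y\<close>, so the
  distance of its values from \<open>y\<close> factorises:
  \<open>y - c x / (c x + 1) = c (1 - y) (t - x) / (1 + c x)\<close>.
  Taking logarithms off the point \<open>x = t\<close> splits the integrand of the potential of \<open>A\<^sub>c\<close>
  into the integrand of the potential of \<open>X\<close>, the integrand of \<open>\<psi>\<close>, and a constant
  (lemma \<open>ln_dist_mobius\<close>).  At \<open>x = t\<close> both potentials contribute \<open>0\<close>, while the other
  two terms contribute \<open>ln (c (1 - y)\<^sup>2)\<close>; this is the correction carried by an atom of
  \<open>F\<close> at \<open>t\<close>.

  The one analytic point is that the potentials may be infinite, so that linearity of the
  Bochner integral is not available.  However, all terms other than the logarithmic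
  singularity are integrable, \<open>ln (1 + c x)\<close> because \<open>\<psi> c\<close> is finite, and adding an
  integrable function shifts an extended integral by a real number whether or not the latter is
  finite (lemma \<open>ext_integral_add_integrable\<close>).
\<close>

lemma ext_integral_distr:
  assumes "T \<in> measurable M N" "f \<in> borel_measurable N"
  shows "ext_integral (distr M N T) f = ext_integral M (\<lambda>x. f (T x))"
  using assms by (simp add: ext_integral_def nn_integral_distr)

lemma ext_integral_cong_AE:
  assumes "AE x in M. f x = g x"
  shows "ext_integral M f = ext_integral M g"
proof -
  have "(\<integral>\<^sup>+ x. ennreal (f x) \<partial>M) = (\<integral>\<^sup>+ x. ennreal (g x) \<partial>M)"
    "(\<integral>\<^sup>+ x. ennreal (- f x) \<partial>M) = (\<integral>\<^sup>+ x. ennreal (- g x) \<partial>M)"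
    using assms by (auto intro!: nn_integral_cong_AE elim!: eventually_mono)
  then show ?thesis by (simp add: ext_integral_def)
qed

lemma integrable_nn_integral_parts:
  fixes h :: "'a \<Rightarrow> real"
  assumes "integrable M h"
  obtains p n where "0 \<le> p" "0 \<le> n" "(\<integral>\<^sup>+ x. ennreal (h x) \<partial>M) = ennreal p"
    "(\<integral>\<^sup>+ x. ennreal (- h x) \<partial>M) = ennreal n" "integral\<^sup>L M h = p - n"
proof -
  have "(\<integral>\<^sup>+ x. ennreal (h x) \<partial>M) \<noteq> \<infinity>" "(\<integral>\<^sup>+ x. ennreal (- h x) \<partial>M) \<noteq> \<infinity>"
    using assms by (auto simp: real_integrable_def)
  then show thesis
    using that[of "enn2real (\<integral>\<^sup>+ x. ennreal (h x) \<partial>M)"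
        "enn2real (\<integral>\<^sup>+ x. ennreal (- h x) \<partial>M)"] real_lebesgue_integral_def[OF assms]
    by (auto simp: less_top)
qed

lemma ext_integral_eq_integral:
  assumes "integrable M h"
  shows "ext_integral M h = ereal (integral\<^sup>L M h)"
  using integrable_nn_integral_parts[OF assms]
  by (metis enn2ereal_ennreal ereal_minus(1) ext_integral_def)

lemma nn_integral_positive_part_add_le:
  fixes f g :: "'a \<Rightarrow> real"
  assumes "f \<in> borel_measurable M" "g \<in> borel_measurable M"
  shows "(\<integral>\<^sup>+ x. ennreal (f x + g x) \<partial>M)
    \<le> (\<integral>\<^sup>+ x. ennreal (f x) \<partial>M) + (\<integral>\<^sup>+ x. ennreal (g x) \<partial>M)"
proof -
  have "(\<integral>\<^sup>+ x. ennreal (f x + g x) \<partial>M) \<le> (\<integral>\<^sup>+ x. ennreal (f x) + ennreal (g x) \<partial>M)"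
  proof (intro nn_integral_mono)
    show "ennreal (f x + g x) \<le> ennreal (f x) + ennreal (g x)" for x
      by (cases "0 \<le> f x"; cases "0 \<le> g x")
        (auto simp: ennreal_neg ennreal_leI simp flip: ennreal_plus)
  qed
  then show ?thesis using assms by (simp add: nn_integral_add)
qed

text \<open>
  Writing \<open>u\<^sup>+\<close> and \<open>u\<^sup>-\<close> for the two parts of \<open>u\<close>, the identity
  \<open>(g + h)\<^sup>+ + g\<^sup>- + h\<^sup>- = (g + h)\<^sup>- + g\<^sup>+ + h\<^sup>+\<close> involves no subtraction and can
  therefore be integrated without any finiteness assumption on \<open>g\<close>.  Since \<open>h\<close> is
  integrable, each part of \<open>g + h\<close> has a finite integral iff the same part of \<open>g\<close> does, and the
  claim follows in each case.  If both parts of \<open>g\<close> have infinite integrals, both sides are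
  \<open>\<infinity> - \<infinity> = \<infinity>\<close>.
\<close>

lemma ext_integral_add_integrable:
  assumes g[measurable]: "g \<in> borel_measurable M" and h: "integrable M h"
  shows "ext_integral M (\<lambda>x. g x + h x) = ext_integral M g + ereal (integral\<^sup>L M h)"
proof -
  have h_meas[measurable]: "h \<in> borel_measurable M" using h by simp
  define P N P' N' where "P = (\<integral>\<^sup>+ x. ennreal (g x) \<partial>M)" and "N = (\<integral>\<^sup>+ x. ennreal (- g x) \<partial>M)"
    and "P' = (\<integral>\<^sup>+ x. ennreal (g x + h x) \<partial>M)" and "N' = (\<integral>\<^sup>+ x. ennreal (- (g x + h x)) \<partial>M)"
  note defs = P_def N_def P'_def N'_def
  obtain p n where pn: "0 \<le> p" "0 \<le> n" "(\<integral>\<^sup>+ x. ennreal (h x) \<partial>M) = ennreal p"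
    "(\<integral>\<^sup>+ x. ennreal (- h x) \<partial>M) = ennreal n" "integral\<^sup>L M h = p - n"
    using integrable_nn_integral_parts[OF h] .
  have parts: "ennreal (a + b) + ennreal (- a) + ennreal (- b)
      = ennreal (- (a + b)) + ennreal a + ennreal b" for a b :: real
    by (cases "0 \<le> a"; cases "0 \<le> b"; cases "0 \<le> a + b")
      (simp_all add: ennreal_neg flip: ennreal_plus)
  have balance: "P' + N + ennreal n = N' + P + ennreal p"
  proof -
    have "P' + N + ennreal n
        = (\<integral>\<^sup>+ x. ennreal (g x + h x) + ennreal (- g x) + ennreal (- h x) \<partial>M)"
      unfolding defs pn(4)[symmetric] by (simp add: nn_integral_add)
    also have "\<dots> = (\<integral>\<^sup>+ x. ennreal (- (g x + h x)) + ennreal (g x) + ennreal (h x) \<partial>M)"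
      by (simp only: parts)
    also have "\<dots> = N' + P + ennreal p"
      unfolding defs pn(3)[symmetric] by (simp add: nn_integral_add del: minus_add_distrib)
    finally show ?thesis .
  qed
  have P'_fin: "P' = \<top> \<longleftrightarrow> P = \<top>"
  proof -
    have "P' \<le> P + ennreal p"
      using nn_integral_positive_part_add_le[OF g h_meas] by (simp add: defs pn)
    moreover have "P \<le> P' + ennreal n"
      using nn_integral_positive_part_add_le[of "\<lambda>x. g x + h x" M "\<lambda>x. - h x"]
      by (simp add: defs pn)
    ultimately show ?thesis by (auto simp: top_unique)
  qed
  have N'_fin: "N' = \<top> \<longleftrightarrow> N = \<top>"
  proof -
    have "N' \<le> N + ennreal n"
      using nn_integral_positive_part_add_le[of "\<lambda>x. - g x" M "\<lambda>x. - h x"]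
      by (simp add: defs pn)
    moreover have "N \<le> N' + ennreal p"
      using nn_integral_positive_part_add_le[of "\<lambda>x. - (g x + h x)" M h]
      by (simp add: defs pn)
    ultimately show ?thesis by (auto simp: top_unique)
  qed
  have "enn2ereal P' - enn2ereal N' = enn2ereal P - enn2ereal N + ereal (p - n)"
    using balance P'_fin N'_fin pn(1,2)
    by (cases P; cases N; cases P'; cases N')
      (auto simp: enn2ereal_ennreal simp flip: ennreal_plus)
  then show ?thesis by (simp add: ext_integral_def defs pn)
qed

lemma integrable_if_nonneg_ext_integral_finite:
  assumes f: "f \<in> borel_measurable M" and nonneg: "AE x in M. 0 \<le> f x"
    and fin: "ext_integral M f < \<infinity>"
  shows "integrable M f"
proof -
  have "(\<integral>\<^sup>+ x. ennreal (- f x) \<partial>M) = (\<integral>\<^sup>+ x. 0 \<partial>M)"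
    using nonneg by (intro nn_integral_cong_AE) (auto elim!: eventually_mono simp: ennreal_neg)
  then have neg: "(\<integral>\<^sup>+ x. ennreal (- f x) \<partial>M) = 0" by simp
  then have "(\<integral>\<^sup>+ x. ennreal (f x) \<partial>M) \<noteq> \<infinity>"
    using fin by (auto simp: ext_integral_def)
  with neg f show ?thesis by (simp add: real_integrable_def)
qed

text \<open>
  Off \<open>t\<close> this is the logarithm of the factorisation of \<open>y - c x / (c x + 1)\<close>.
  At \<open>x = t\<close> one has \<open>1 + c t = 1 / (1 - y)\<close>, hence
  \<open>ln (c (1 - y)) - ln (1 + c t) = ln (c (1 - y)\<^sup>2)\<close>, which the multiple of
  \<open>indicator {t}\<close> cancels.
\<close>

lemma ln_dist_mobius:
  fixes c y x t :: real
  assumes "0 < c" "y < 1" "0 \<le> x" and t: "t = y / (c * (1 - y))"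
  shows "ln \<bar>y - c * x / (c * x + 1)\<bar> * indicator {a. y \<noteq> a} (c * x / (c * x + 1))
    = ln \<bar>t - x\<bar> * indicator {a. t \<noteq> a} x
      + (ln (c * (1 - y)) - ln (1 + c * x) - ln (c * (1 - y)\<^sup>2) * indicator {t} x)"
proof -
  have pos: "0 < 1 + c * x" "0 < c * (1 - y)"
    using assms by (auto intro: add_pos_nonneg)
  have ty: "c * (1 - y) * t = y" using assms by simp
  have "y - c * x / (c * x + 1) = (y - c * (1 - y) * x) / (1 + c * x)"
    using pos by (simp add: field_simps)
  also have "y - c * (1 - y) * x = c * (1 - y) * (t - x)"
    using ty by (simp add: right_diff_distrib)
  finally have fact: "y - c * x / (c * x + 1) = c * (1 - y) * (t - x) / (1 + c * x)" .
  show ?thesis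
  proof (cases "x = t")
    case True
    then have "y = c * x / (c * x + 1)" using fact by simp
    moreover have "1 + c * x = 1 / (1 - y)"
    proof -
      have "(1 + c * x) * (1 - y) = 1 - y + c * (1 - y) * t"
        using True by (simp add: algebra_simps)
      then have "(1 + c * x) * (1 - y) = 1" using ty by simp
      then show ?thesis using assms(2) by (simp only: nonzero_eq_divide_eq)
    qed
    moreover have "ln (c * (1 - y)\<^sup>2) = ln (c * (1 - y)) + ln (1 - y)"
      using assms by (simp add: ln_mult ln_realpow)
    ultimately show ?thesis
      using True assms by (simp add: ln_div)
  next
    case False
    then have "y - c * x / (c * x + 1) \<noteq> 0" using fact pos False assms(1,2) by simp
    then have "y \<noteq> c * x / (c * x + 1)" by simp
    moreover have "ln \<bar>y - c * x / (c * x + 1)\<bar>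
        = ln (c * (1 - y)) + ln \<bar>t - x\<bar> - ln (1 + c * x)"
    proof -
      have "\<bar>y - c * x / (c * x + 1)\<bar> = (c * (1 - y)) * \<bar>t - x\<bar> / (1 + c * x)"
        unfolding fact abs_divide abs_mult[of "c * (1 - y)"] using pos by simp
      moreover have "0 < \<bar>t - x\<bar>" using False by simp
      ultimately show ?thesis using pos by (simp only: ln_divide_pos ln_mult_pos mult_pos_pos)
    qed
    ultimately show ?thesis using False by simp
  qed
qed

theorem proposition3p2:
  fixes M :: "'a measure" and X :: "'a \<Rightarrow> real" and c y :: real
  assumes "prob_space M"
    and "X \<in> borel_measurable M"
    and "AE \<omega> in M. 0 \<le> X \<omega>"
    and "\<forall>l>0. psi (distr M borel X) l < \<infinity>"
    and "0 < c" and "0 < y" and "y < 1"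
  shows "(measure (distr M borel X) {y / (c * (1 - y))} = 0 \<longrightarrow>
            Phi (distr M borel (\<lambda>\<omega>. c * X \<omega> / (c * X \<omega> + 1))) y =
              Phi (distr M borel X) (y / (c * (1 - y)))
              - psi (distr M borel X) c + ereal (ln (c * (1 - y)))) \<and>
         Phi (distr M borel (\<lambda>\<omega>. c * X \<omega> / (c * X \<omega> + 1))) y =
           Phi (distr M borel X) (y / (c * (1 - y)))
           - psi (distr M borel X) c + ereal (ln (c * (1 - y)))
           - ereal (measure (distr M borel X) {y / (c * (1 - y))} * ln (c * (1 - y)\<^sup>2))"
proof -
  interpret prob_space M by fact
  note [measurable] = assms(2)
  define F where "F = distr M borel X"
  define t where "t = y / (c * (1 - y))"
  define K where "K = ln (c * (1 - y)\<^sup>2)"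
  interpret F: prob_space F unfolding F_def by (rule prob_space_distr) simp
  have sets_F[measurable_cong]: "sets F = sets borel" by (simp add: F_def)
  have nonneg: "AE x in F. 0 \<le> x"
    unfolding F_def by (subst AE_distr_iff) (use assms(3) in simp_all)
  have int_ln: "integrable F (\<lambda>x. ln (1 + c * x))"
  proof (rule integrable_if_nonneg_ext_integral_finite)
    show "AE x in F. 0 \<le> ln (1 + c * x)"
      using nonneg by eventually_elim (use assms(5) in simp)
    show "ext_integral F (\<lambda>x. ln (1 + c * x)) < \<infinity>"
      using assms(4,5) by (simp add: psi_def F_def)
  qed measurable
  have int_atom: "integrable F (\<lambda>x. K * indicator {t} x)"
    by (intro integrable_mult_right) (auto simp: F.emeasure_eq_measure sets_F)
  define h where "h x = ln (c * (1 - y)) - ln (1 + c * x) - K * indicator {t} x" for x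
  have h: "integrable F h"
    unfolding h_def using int_ln int_atom by simp
  have int_h: "integral\<^sup>L F h
      = ln (c * (1 - y)) - (\<integral>x. ln (1 + c * x) \<partial>F) - K * measure F {t}"
    unfolding h_def using int_ln int_atom by (simp add: sets_F F.prob_space)
  have law_A: "distr M borel (\<lambda>\<omega>. c * X \<omega> / (c * X \<omega> + 1))
      = distr F borel (\<lambda>x. c * x / (c * x + 1))"
    unfolding F_def by (subst distr_distr) (simp_all add: comp_def)
  have "Phi (distr M borel (\<lambda>\<omega>. c * X \<omega> / (c * X \<omega> + 1))) y
      = ext_integral F (\<lambda>x. ln \<bar>y - c * x / (c * x + 1)\<bar>
          * indicator {a. y \<noteq> a} (c * x / (c * x + 1)))"
    unfolding law_A Phi_def by (rule ext_integral_distr) measurable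
  also have "\<dots> = ext_integral F (\<lambda>x. ln \<bar>t - x\<bar> * indicator {a. t \<noteq> a} x + h x)"
    using nonneg ln_dist_mobius[OF assms(5,7) _ t_def]
    by (intro ext_integral_cong_AE) (auto elim!: eventually_mono simp: h_def K_def)
  also have "\<dots> = Phi F t + ereal (integral\<^sup>L F h)"
    unfolding Phi_def by (intro ext_integral_add_integrable h) measurable
  also have "\<dots> = Phi F t - psi F c + ereal (ln (c * (1 - y))) - ereal (measure F {t} * K)"
    unfolding int_h psi_def ext_integral_eq_integral[OF int_ln]
    by (cases "Phi F t") (simp_all add: mult.commute)
  finally have main: "Phi (distr M borel (\<lambda>\<omega>. c * X \<omega> / (c * X \<omega> + 1))) y
      = Phi F t - psi F c + ereal (ln (c * (1 - y))) - ereal (measure F {t} * K)" .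
  then show ?thesis
    unfolding F_def t_def K_def by (simp add: zero_ereal_def[symmetric])
qed

end
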